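(* Let $G$ be a finite simple graph of order $n$ with at least one edge such that $es_{\chi'}(G)=\lfloor \frac{n}{2} \rfloor -1=k$. Then there exists a mitigating set of $G$ which is a $k$-matching.
   Context: All graphs are finite, simple and have at least one edge. $\chi'(G)$ is the chromatic index of $G$. A mitigating set of $G$ is a set of edges $F\subseteq E(G)$ such that $\chi'(G\setminus F)<\chi'(G)$, where $G\setminus F$ is $G$ with the edges of $F$ deleted (all vertices are kept; an edgeless graph has chromatic index $0$). The chromatic edge stability index $es_{\chi'}(G)$ is the minimum cardinality of a mitigating set of $G$. A matching is a set of pairwise non-adjacent edges; a $k$-matching is a matching of size $k$. *)

theory Defs
  imports Main
begin

text \<open>An edge is the two-element set of its end vertices, so loops and multiple edges
  cannot occur.\<close>

record 'a graph =
  verts :: "'a set"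
  edges :: "'a set set"

definition finite_simple_graph :: "'a graph \<Rightarrow> bool" where
  "finite_simple_graph G \<longleftrightarrow>
     finite (verts G) \<and> (\<forall>e\<in>edges G. e \<subseteq> verts G \<and> card e = 2)"

definition delete_edges :: "'a graph \<Rightarrow> 'a set set \<Rightarrow> 'a graph" where
  "delete_edges G F = G\<lparr>edges := edges G - F\<rparr>"

definition adjacent_edges :: "'a set \<Rightarrow> 'a set \<Rightarrow> bool" where
  "adjacent_edges e f \<longleftrightarrow> e \<noteq> f \<and> e \<inter> f \<noteq> {}"

definition proper_edge_colouring :: "'a graph \<Rightarrow> nat \<Rightarrow> ('a set \<Rightarrow> nat) \<Rightarrow> bool" where
  "proper_edge_colouring G k c \<longleftrightarrow>
     (\<forall>e\<in>edges G. c e < k) \<and>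
     (\<forall>e\<in>edges G. \<forall>f\<in>edges G. adjacent_edges e f \<longrightarrow> c e \<noteq> c f)"

definition chromatic_index :: "'a graph \<Rightarrow> nat" where
  "chromatic_index G = (LEAST k. \<exists>c. proper_edge_colouring G k c)"

definition mitigating_set :: "'a graph \<Rightarrow> 'a set set \<Rightarrow> bool" where
  "mitigating_set G F \<longleftrightarrow>
     F \<subseteq> edges G \<and> chromatic_index (delete_edges G F) < chromatic_index G"

text \<open>For a finite simple graph with at least one edge the set of all edges is mitigating,
  so the minimum below exists.\<close>

definition chromatic_edge_stability_index :: "'a graph \<Rightarrow> nat" where
  "chromatic_edge_stability_index G = (LEAST m. \<exists>F. mitigating_set G F \<and> card F = m)"

definition matching :: "'a graph \<Rightarrow> 'a set set \<Rightarrow> bool" where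
  "matching G M \<longleftrightarrow> M \<subseteq> edges G \<and> (\<forall>e\<in>M. \<forall>f\<in>M. \<not> adjacent_edges e f)"

definition k_matching :: "nat \<Rightarrow> 'a graph \<Rightarrow> 'a set set \<Rightarrow> bool" where
  "k_matching k G M \<longleftrightarrow> matching G M \<and> card M = k"

end

theory Submission
  imports Defs
begin

text \<open>
  Write \<open>\<chi>\<close> for the chromatic index and \<open>k\<close> for the chromatic edge stability index. Deleting one
  colour class of an optimal colouring saves a colour, so every such class is a mitigating matching
  and has at least \<open>k\<close> edges. It remains to find an optimal colour class with at most \<open>k\<close> edges.

  This is a count. Every matching has at most \<open>n div 2 \<le> k + 1\<close> edges. Delete a mitigating set of
  \<open>k\<close> edges: what is left is covered by at most \<open>\<chi> - 1\<close> matchings, so \<open>G\<close> has at most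
  \<open>(\<chi> - 1) * (k + 1) + k < \<chi> * (k + 1)\<close> edges. Hence the \<open>\<chi>\<close> classes of an optimal colouring cannot
  all have \<open>k + 1\<close> edges (\<open>small_colour_class\<close>).
\<close>

definition colour_class :: "'a graph \<Rightarrow> ('a set \<Rightarrow> nat) \<Rightarrow> nat \<Rightarrow> 'a set set" where
  "colour_class G c i = {e \<in> edges G. c e = i}"

lemma finite_edges: "finite_simple_graph G \<Longrightarrow> finite (edges G)"
  unfolding finite_simple_graph_def by (meson PowI finite_Pow_iff finite_subset subsetI)

lemma finite_simple_graph_delete_edges:
  "finite_simple_graph G \<Longrightarrow> finite_simple_graph (delete_edges G F)"
  by (auto simp: finite_simple_graph_def delete_edges_def)

lemma verts_delete_edges [simp]: "verts (delete_edges G F) = verts G"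
  and edges_delete_edges [simp]: "edges (delete_edges G F) = edges G - F"
  by (simp_all add: delete_edges_def)

lemma chromatic_index_le: "proper_edge_colouring G k c \<Longrightarrow> chromatic_index G \<le> k"
  unfolding chromatic_index_def by (rule Least_le) blast

lemma optimal_colouring_exists:
  assumes "finite_simple_graph G"
  obtains c where "proper_edge_colouring G (chromatic_index G) c"
proof -
  obtain f :: "'a set \<Rightarrow> nat" and m
    where "f ` edges G = {i. i < m}" "inj_on f (edges G)"
    using finite_imp_inj_to_nat_seg[OF finite_edges[OF assms]] by blast
  \<comment> \<open>Giving all edges distinct colours is proper.\<close>
  then have "proper_edge_colouring G m f"
    by (auto simp: proper_edge_colouring_def adjacent_edges_def inj_on_def)
  then have "\<exists>c. proper_edge_colouring G (chromatic_index G) c"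
    unfolding chromatic_index_def
    by (rule LeastI[where P = "\<lambda>k. \<exists>c. proper_edge_colouring G k c", OF exI])
  with that show thesis by blast
qed

lemma chromatic_index_pos:
  assumes "finite_simple_graph G" "edges G \<noteq> {}"
  shows "0 < chromatic_index G"
  using optimal_colouring_exists[OF assms(1)] assms(2)
  by (metis all_not_in_conv gr_implies_not0 gr0I proper_edge_colouring_def)

lemma stability_index_le:
  "mitigating_set G F \<Longrightarrow> chromatic_edge_stability_index G \<le> card F"
  unfolding chromatic_edge_stability_index_def by (rule Least_le) blast

lemma minimum_mitigating_set_exists:
  assumes "finite_simple_graph G" "edges G \<noteq> {}"
  obtains F where "mitigating_set G F" "card F = chromatic_edge_stability_index G"
proof -
  have "proper_edge_colouring (delete_edges G (edges G)) 0 c" for c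
    by (simp add: proper_edge_colouring_def)
  then have "mitigating_set G (edges G)"
    using chromatic_index_pos[OF assms] chromatic_index_le
    by (fastforce simp: mitigating_set_def)
  then have "\<exists>m F. mitigating_set G F \<and> card F = m" by blast
  then have "\<exists>F. mitigating_set G F \<and> card F = chromatic_edge_stability_index G"
    unfolding chromatic_edge_stability_index_def by (rule LeastI_ex)
  with that show thesis by blast
qed

lemma matching_colour_class:
  "proper_edge_colouring G k c \<Longrightarrow> matching G (colour_class G c i)"
  unfolding proper_edge_colouring_def matching_def colour_class_def by fastforce

lemma card_matching_le:
  assumes "finite_simple_graph G" "matching G M"
  shows "card M \<le> card (verts G) div 2"
proof -
  have M: "M \<subseteq> edges G" and sub: "\<Union>M \<subseteq> verts G" and fin: "finite (verts G)"
    using assms by (auto simp: matching_def finite_simple_graph_def)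
  have "2 * card M = card (\<Union>M)"
  proof (rule card_partition)
    show "finite M" using M finite_edges[OF assms(1)] by (rule finite_subset)
    show "finite (\<Union>M)" using sub fin by (rule finite_subset)
    show "card e = 2" if "e \<in> M" for e
      using that M assms(1) by (auto simp: finite_simple_graph_def)
    show "e \<inter> f = {}" if "e \<in> M" "f \<in> M" "e \<noteq> f" for e f
      using that assms(2) unfolding matching_def adjacent_edges_def by blast
  qed
  also have "\<dots> \<le> card (verts G)" by (rule card_mono[OF fin sub])
  finally show ?thesis by simp
qed

lemma card_edges_eq_sum_colour_classes:
  assumes "finite_simple_graph G" "proper_edge_colouring G k c"
  shows "card (edges G) = (\<Sum>i<k. card (colour_class G c i))"
proof -
  have "edges G = (\<Union>i<k. colour_class G c i)"
    using assms(2) by (auto simp: proper_edge_colouring_def colour_class_def)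
  moreover have "finite (colour_class G c i)" for i
    using finite_edges[OF assms(1)] by (simp add: colour_class_def)
  moreover have "colour_class G c i \<inter> colour_class G c j = {}" if "i \<noteq> j" for i j
    using that by (auto simp: colour_class_def)
  ultimately show ?thesis by (simp add: card_UN_disjoint)
qed

lemma card_edges_le:
  assumes "finite_simple_graph G"
  shows "card (edges G) \<le> chromatic_index G * (card (verts G) div 2)"
proof -
  obtain c where c: "proper_edge_colouring G (chromatic_index G) c"
    using optimal_colouring_exists[OF assms] .
  show ?thesis
    using sum_bounded_above[of "{..<chromatic_index G}" "\<lambda>i. card (colour_class G c i)"]
      card_matching_le[OF assms matching_colour_class[OF c]]
    by (simp add: card_edges_eq_sum_colour_classes[OF assms c])
qed

text \<open>
  The deleted class leaves a gap in the palette; giving its colour to the edges of the last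
  colour frees the last colour. When the deleted class is itself the last one, nothing is recoloured.
\<close>

lemma mitigating_colour_class:
  assumes c: "proper_edge_colouring G (chromatic_index G) c"
    and i: "i < chromatic_index G"
  shows "mitigating_set G (colour_class G c i)"
proof -
  let ?last = "chromatic_index G - 1"
  have "proper_edge_colouring (delete_edges G (colour_class G c i)) ?last
          (\<lambda>e. if c e = ?last then i else c e)"
    unfolding proper_edge_colouring_def
  proof (intro conjI ballI impI)
    fix e assume e: "e \<in> edges (delete_edges G (colour_class G c i))"
    then have "c e < chromatic_index G" "c e \<noteq> i"
      using c by (auto simp: proper_edge_colouring_def colour_class_def)
    then show "(if c e = ?last then i else c e) < ?last" using i by auto
  next
    fix e f
    assume "e \<in> edges (delete_edges G (colour_class G c i))"
      "f \<in> edges (delete_edges G (colour_class G c i))" "adjacent_edges e f"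
    then have "c e \<noteq> c f" "c e \<noteq> i" "c f \<noteq> i"
      using c by (auto simp: proper_edge_colouring_def colour_class_def)
    then show "(if c e = ?last then i else c e) \<noteq> (if c f = ?last then i else c f)" by auto
  qed
  then show ?thesis
    using chromatic_index_le i by (fastforce simp: mitigating_set_def colour_class_def)
qed

text \<open>
  If every class had more than \<open>m = card F\<close> edges, then \<open>G\<close> would have at least
  \<open>\<chi> * (m + 1)\<close> edges, whereas after deleting \<open>F\<close> fewer than \<open>\<chi>\<close> matchings of at most
  \<open>m + 1\<close> edges suffice.
\<close>

lemma small_colour_class:
  assumes G: "finite_simple_graph G"
    and F: "mitigating_set G F"
    and large: "card (verts G) div 2 \<le> card F + 1"
    and c: "proper_edge_colouring G (chromatic_index G) c"
  obtains i where "i < chromatic_index G" "card (colour_class G c i) \<le> card F"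
proof (rule ccontr)
  let ?H = "delete_edges G F"
  assume "\<not> thesis"
  with that have "card F + 1 \<le> card (colour_class G c i)" if "i < chromatic_index G" for i
    using \<open>i < chromatic_index G\<close> by (metis Suc_eq_plus1 not_less_eq_eq)
  then have "chromatic_index G * (card F + 1) \<le> card (edges G)"
    using sum_bounded_below[of "{..<chromatic_index G}" "card F + 1"
        "\<lambda>i. card (colour_class G c i)"]
    by (simp add: card_edges_eq_sum_colour_classes[OF G c])
  also have "card (edges G) \<le> card (edges ?H) + card F"
    using diff_card_le_card_Diff[of F "edges G"] F finite_edges[OF G]
    by (auto simp: mitigating_set_def dest: finite_subset)
  also have "card (edges ?H) \<le> chromatic_index ?H * (card F + 1)"
    using card_edges_le[OF finite_simple_graph_delete_edges[OF G], of F] large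
    by (metis le_trans mult_le_mono2 verts_delete_edges)
  also have "chromatic_index ?H * (card F + 1) + card F < (chromatic_index ?H + 1) * (card F + 1)"
    by simp
  also have "\<dots> \<le> chromatic_index G * (card F + 1)"
    using F by (intro mult_right_mono) (auto simp: mitigating_set_def)
  finally show False by simp
qed

theorem theorem5p15:
  fixes G :: "'a graph" and n k :: nat
  assumes "finite_simple_graph G"
    and "edges G \<noteq> {}"
    and "card (verts G) = n"
    and "chromatic_edge_stability_index G = n div 2 - 1"
    and "n div 2 - 1 = k"
  shows "\<exists>F. mitigating_set G F \<and> k_matching k G F"
proof -
  obtain F where F: "mitigating_set G F" "card F = k"
    using minimum_mitigating_set_exists[OF assms(1,2)] assms(4,5) by metis
  obtain c where c: "proper_edge_colouring G (chromatic_index G) c"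
    using optimal_colouring_exists[OF assms(1)] .
  have "card (verts G) div 2 \<le> card F + 1" using assms(3,5) F(2) by simp
  then obtain i where i: "i < chromatic_index G" and le: "card (colour_class G c i) \<le> k"
    using small_colour_class[OF assms(1) F(1) _ c] F(2) by metis
  have mit: "mitigating_set G (colour_class G c i)"
    using mitigating_colour_class[OF c i] .
  then have "k \<le> card (colour_class G c i)"
    using stability_index_le assms(4,5) by metis
  with le mit matching_colour_class[OF c] show ?thesis
    by (auto simp: k_matching_def)
qed

end
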